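(* For any given $r>0$, the Hessian matrix $\nabla^2J(K,\alpha)$ (with respect to $K$) is positive definite over $\|K\|\le r$ for all large $\alpha$; that is, there is $\alpha_0$ such that for all $\alpha\ge\alpha_0$ and all $K\in\mathbb{R}^{m\times n}$ with $\|K\|\le r$, the Hessian of $J(\cdot,\alpha)$ at $K$ is positive definite.
   Context: Setting. Let $A\in\mathbb{R}^{n\times n}$, $B\in\mathbb{R}^{n\times m}$, $Q\in\mathbb{R}^{n\times n}$ symmetric positive semidefinite, $R\in\mathbb{R}^{m\times m}$ symmetric positive definite, and $D_0\in\mathbb{R}^{n\times n}$ symmetric positive definite. A real square matrix is stable if all its eigenvalues lie in the open left half plane. For a damping parameter $\alpha$ and $K\in\mathbb{R}^{m\times n}$ such that $A-\alpha I+BK$ is stable, define $$J(K,\alpha)=\mathbb{E}\int_0^\infty\left[x(t)^\top Qx(t)+u(t)^\top Ru(t)\right]dt,\quad \dot x(t)=(A-\alpha I)x(t)+Bu(t),\ u(t)=Kx(t),$$ where $x(0)=x_0$ is a random vector with zero mean and $\mathbb{E}[x_0x_0^\top]=D_0$. Equivalently, $J(K,\alpha)=\mathrm{tr}(D_0P)$ where $P$ is the unique solution of $(A-\alpha I+BK)^\top P+P(A-\alpha I+BK)+K^\top RK+Q=0$. The Hessian is the $mn\times mn$ Hessian of $J(\cdot,\alpha)$ as a function of $\mathrm{vec}(K)\in\mathbb{R}^{mn}$ (on the open set of $K$ with $A-\alpha I+BK$ stable). $\|\cdot\|$ is the operator norm. *)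

theory Defs
  imports "HOL-Probability.Probability"
begin

definition pos_semidef :: "real^'n^'n \<Rightarrow> bool" where
  "pos_semidef S \<longleftrightarrow> transpose S = S \<and> (\<forall>x. 0 \<le> x \<bullet> (S *v x))"

definition pos_def :: "real^'n^'n \<Rightarrow> bool" where
  "pos_def S \<longleftrightarrow> transpose S = S \<and> (\<forall>x. x \<noteq> 0 \<longrightarrow> 0 < x \<bullet> (S *v x))"

definition complex_matrix :: "real^'n^'m \<Rightarrow> complex^'n^'m" where
  "complex_matrix M = (\<chi> i j. complex_of_real (M $ i $ j))"

(* Eigenvalues of a real matrix are taken in the complex numbers. *)
definition eigenvalue :: "real^'n^'n \<Rightarrow> complex \<Rightarrow> bool" where
  "eigenvalue M \<mu> \<longleftrightarrow> (\<exists>v. v \<noteq> 0 \<and> complex_matrix M *v v = \<mu> *s v)"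

definition stable_matrix :: "real^'n^'n \<Rightarrow> bool" where
  "stable_matrix M \<longleftrightarrow> (\<forall>\<mu>. eigenvalue M \<mu> \<longrightarrow> Re \<mu> < 0)"

definition damped :: "real^'n^'n \<Rightarrow> real \<Rightarrow> real^'n^'n" where
  "damped A \<alpha> = A - \<alpha> *\<^sub>R mat 1"

(* A linear system with constant coefficients has exactly one solution on the whole real
   line for each initial value, so the description below is proper.  Only its values at
   nonnegative times enter the cost. *)
definition state ::
    "real^'n^'n \<Rightarrow> real^'m^'n \<Rightarrow> real^'n^'m \<Rightarrow> real \<Rightarrow> real^'n \<Rightarrow> real \<Rightarrow> real^'n" where
  "state A B K \<alpha> \<xi> =
     (THE x. x 0 = \<xi> \<and>
        (\<forall>t. (x has_vector_derivative (damped A \<alpha> *v x t + B *v (K *v x t))) (at t)))"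

definition control ::
    "real^'n^'n \<Rightarrow> real^'m^'n \<Rightarrow> real^'n^'m \<Rightarrow> real \<Rightarrow> real^'n \<Rightarrow> real \<Rightarrow> real^'m" where
  "control A B K \<alpha> \<xi> t = K *v state A B K \<alpha> \<xi> t"

definition trajectory_cost ::
    "real^'n^'n \<Rightarrow> real^'m^'n \<Rightarrow> real^'n^'n \<Rightarrow> real^'m^'m \<Rightarrow> real^'n^'m \<Rightarrow> real \<Rightarrow> real^'n \<Rightarrow> real" where
  "trajectory_cost A B Q R K \<alpha> \<xi> =
     (LBINT t:{0..}.
        state A B K \<alpha> \<xi> t \<bullet> (Q *v state A B K \<alpha> \<xi> t)
      + control A B K \<alpha> \<xi> t \<bullet> (R *v control A B K \<alpha> \<xi> t))"

(* The integrals are Bochner integrals, hence 0 where they diverge: the value is the expected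
   cost of the gain K when the closed loop matrix is stable, and is not to be used otherwise. *)
definition cost ::
    "'w measure \<Rightarrow> ('w \<Rightarrow> real^'n) \<Rightarrow> real^'n^'n \<Rightarrow> real^'m^'n \<Rightarrow> real^'n^'n \<Rightarrow> real^'m^'m
      \<Rightarrow> real^'n^'m \<Rightarrow> real \<Rightarrow> real" where
  "cost M x0 A B Q R K \<alpha> = (\<integral>\<omega>. trajectory_cost A B Q R K \<alpha> (x0 \<omega>) \<partial>M)"

definition outer :: "real^'n \<Rightarrow> real^'n \<Rightarrow> real^'n^'n" where
  "outer x y = (\<chi> i j. x $ i * y $ j)"

(* The initial state: zero mean and second moment matrix D0. *)
definition initial_distribution ::
    "'w measure \<Rightarrow> ('w \<Rightarrow> real^'n) \<Rightarrow> real^'n^'n \<Rightarrow> bool" where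
  "initial_distribution M x0 D0 \<longleftrightarrow>
     prob_space M \<and> x0 \<in> borel_measurable M \<and>
     integrable M x0 \<and> (\<integral>\<omega>. x0 \<omega> \<partial>M) = 0 \<and>
     integrable M (\<lambda>\<omega>. outer (x0 \<omega>) (x0 \<omega>)) \<and> (\<integral>\<omega>. outer (x0 \<omega>) (x0 \<omega>) \<partial>M) = D0"

(* The entries of a matrix, as a vector indexed by pairs (row, column).  The order in which
   the entries are listed is immaterial. *)
definition vec_of_matrix :: "real^'n^'m \<Rightarrow> real^('m \<times> 'n)" where
  "vec_of_matrix K = (\<chi> p. K $ fst p $ snd p)"

definition matrix_of_vec :: "real^('m \<times> 'n) \<Rightarrow> real^'n^'m" where
  "matrix_of_vec v = (\<chi> i j. v $ (i, j))"

(* H is the Hessian matrix of f at x: near x the function f has a gradient g, and the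
   Jacobian matrix of g at x is H. *)
definition has_hessian :: "(real^'k \<Rightarrow> real) \<Rightarrow> real^'k^'k \<Rightarrow> real^'k \<Rightarrow> bool" where
  "has_hessian f H x \<longleftrightarrow>
     (\<exists>g. (\<forall>\<^sub>F y in nhds x. (f has_derivative (\<lambda>h. g y \<bullet> h)) (at y)) \<and>
          (g has_derivative (\<lambda>h. H *v h)) (at x))"

end

theory Submission
  imports Defs
begin

text \<open>
  The cost is \<open>D0 \<bullet> P\<close>, where \<open>P\<close> solves the Lyapunov equation \<open>2 \<alpha> P = T P + Q + K\<^sup>T R K\<close> with
  \<open>T P = (A + B K)\<^sup>T P + P (A + B K)\<close>: along a trajectory the derivative of \<open>x \<bullet> P x\<close> is minus the
  running cost. For large \<open>\<alpha>\<close> the operator \<open>2 \<alpha> - T\<close> is invertible with inverse of norm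
  \<open>O(1/\<alpha>)\<close>, uniformly on bounded sets of \<open>K\<close>. Differentiating the equation twice gives
  \<open>2 \<alpha> P'' = 2 h\<^sup>T R h + O(1/\<alpha>)\<close> in direction \<open>h\<close>, so the Hessian of the cost, multiplied by \<open>\<alpha>\<close>,
  tends to the quadratic form \<open>D0 \<bullet> h\<^sup>T R h\<close>, which is positive definite.
\<close>

section \<open>Solutions of damped linear equations depending on a parameter\<close>

text \<open>The bound makes \<open>a - T\<close> injective, and in finite dimension an injective
  linear endomorphism is bijective.\<close>

lemma affine_coercive_solvable:
  fixes T :: "'v::euclidean_space \<Rightarrow> 'v"
  assumes "linear T" and T: "\<And>p. norm (T p) \<le> c * norm p" and "c < a"
  shows "\<exists>!p. a *\<^sub>R p = T p + s"
proof -
  define L where "L p = a *\<^sub>R p - T p" for p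
  have L: "linear L"
    unfolding L_def using \<open>linear T\<close>
    by (intro linear_compose_sub linear_compose_scale_right linear_ident) 
  have "p = 0" if "L p = 0" for p
  proof -
    have "norm (a *\<^sub>R p) = norm (T p)"
      using that by (simp add: L_def)
    then have "a * norm p \<le> c * norm p"
      using T[of p] abs_ge_self[of a] mult_right_mono[of a "\<bar>a\<bar>" "norm p"] by simp
    then show ?thesis
      using \<open>c < a\<close> by (simp add: mult_le_cancel_right)
  qed
  then have "inj L"
    using L by (simp add: linear_injective_0)
  then have "bij L"
    using L linear_injective_imp_surjective bij_def by blast
  then have "\<exists>!p. L p = s"
    unfolding bij_iff by blast
  then show ?thesis
    by (simp add: L_def algebra_simps)
qed

text \<open>The Lyapunov operator is affine in the gain, \<open>T0 + T1 y\<close>. One constant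
  \<open>c\<close> bounds it on the whole ball, so a single \<open>a\<close> above \<open>c\<close>
  serves all parameters; in the application \<open>a\<close> is \<open>2 * \<alpha>\<close>.\<close>

locale damped_family =
  fixes T0 :: "'v::euclidean_space \<Rightarrow> 'v"
    and T1 :: "'w::real_normed_vector \<Rightarrow> 'v \<Rightarrow> 'v"
    and c a \<rho> :: real
  assumes T0: "bounded_linear T0" and T1: "bounded_bilinear T1"
    and bound: "\<And>y p. norm y < \<rho> \<Longrightarrow> norm (T0 p + T1 y p) \<le> c * norm p"
    and c_less_a: "c < a"
begin

text \<open>For \<open>norm y < \<rho>\<close> this is the inverse of \<open>a - T0 - T1 y\<close>,
  applied to \<open>s\<close>.\<close>

definition sol :: "'w \<Rightarrow> 'v \<Rightarrow> 'v" where
  "sol y s = (THE p. a *\<^sub>R p = T0 p + T1 y p + s)"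

lemma ex1_sol:
  assumes "norm y < \<rho>"
  shows "\<exists>!p. a *\<^sub>R p = T0 p + T1 y p + s"
proof (rule affine_coercive_solvable)
  show "linear (\<lambda>p. T0 p + T1 y p)"
    using T0 bounded_bilinear.bounded_linear_right[OF T1]
    by (intro linear_compose_add bounded_linear.linear)
qed (use bound assms c_less_a in auto)

lemma sol_eq:
  assumes "norm y < \<rho>"
  shows "a *\<^sub>R sol y s = T0 (sol y s) + T1 y (sol y s) + s"
  unfolding sol_def by (rule theI'[OF ex1_sol[OF assms]])

lemma sol_unique:
  assumes "norm y < \<rho>" "a *\<^sub>R p = T0 p + T1 y p + s"
  shows "p = sol y s"
  using ex1_sol[OF assms(1)] sol_eq[OF assms(1)] assms(2) by blast

lemma norm_sol:
  assumes "norm y < \<rho>"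
  shows "norm (sol y s) \<le> norm s / (a - c)"
proof -
  let ?p = "sol y s"
  have "a * norm ?p \<le> norm (a *\<^sub>R ?p)"
    by (simp add: mult_right_mono)
  also have "\<dots> \<le> c * norm ?p + norm s"
    unfolding sol_eq[OF assms] by (rule norm_triangle_mono[OF bound[OF assms]]) simp
  finally show ?thesis
    using c_less_a by (simp add: field_simps)
qed

lemma bounded_linear_sol:
  assumes y: "norm y < \<rho>"
  shows "bounded_linear (sol y)"
proof (rule bounded_linear_intro)
  note simps = linear_add[OF bounded_linear.linear[OF T0]] linear_cmul[OF bounded_linear.linear[OF T0]]
    bounded_bilinear.add_right[OF T1] bounded_bilinear.scaleR_right[OF T1]
  fix s t k
  show "sol y (s + t) = sol y s + sol y t"
  proof (rule sol_unique[OF y, symmetric])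
    show "a *\<^sub>R (sol y s + sol y t) = T0 (sol y s + sol y t) + T1 y (sol y s + sol y t) + (s + t)"
      unfolding scaleR_add_right sol_eq[OF y] simps by (simp add: ac_simps)
  qed
  show "sol y (k *\<^sub>R s) = k *\<^sub>R sol y s"
  proof (rule sol_unique[OF y, symmetric])
    have "a *\<^sub>R k *\<^sub>R sol y s = k *\<^sub>R (a *\<^sub>R sol y s)"
      by (simp add: mult.commute)
    then show "a *\<^sub>R k *\<^sub>R sol y s = T0 (k *\<^sub>R sol y s) + T1 y (k *\<^sub>R sol y s) + k *\<^sub>R s"
      unfolding sol_eq[OF y] simps by (simp add: scaleR_add_right)
  qed
  show "norm (sol y s) \<le> norm s * (1 / (a - c))"
    using norm_sol[OF y] by simp
qed

text \<open>Expressing the solution at \<open>y\<close> through the solution operator at the fixed point \<open>x\<close> reduces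
  differentiability of \<open>sol\<close> to differentiability of its argument.\<close>

lemma sol_perturb:
  assumes x: "norm x < \<rho>" and y: "norm y < \<rho>"
  shows "sol y t = sol x (t + T1 (y - x) (sol y t))"
proof (rule sol_unique[OF x])
  show "a *\<^sub>R sol y t = T0 (sol y t) + T1 x (sol y t) + (t + T1 (y - x) (sol y t))"
    unfolding sol_eq[OF y] bounded_bilinear.diff_left[OF T1] by simp
qed

lemma eventually_norm_less: "norm x < \<rho> \<Longrightarrow> \<forall>\<^sub>F y in nhds x. norm y < \<rho>"
  for x :: 'w
  by (intro order_tendstoD(2)[of norm "norm x"] tendsto_norm filterlim_ident)

text \<open>The difference of the solutions is \<open>sol y\<close> of a term tending to zero, and
  the bound \<open>1 / (a - c)\<close> on \<open>sol y\<close> is the same for all \<open>y\<close>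
  in the ball, so convergence follows without knowing how \<open>sol y\<close> varies with
  \<open>y\<close>.\<close>

lemma continuous_sol:
  assumes x: "norm x < \<rho>" and s: "isCont s x"
  shows "isCont (\<lambda>y. sol y (s y)) x"
proof -
  have eq: "sol y (s y) - sol x (s x) = sol y (s y - s x + T1 (y - x) (sol x (s x)))"
    if y: "norm y < \<rho>" for y
  proof -
    let ?d = "T1 (y - x) (sol x (s x))"
    interpret sol: bounded_linear "sol y"
      by (rule bounded_linear_sol[OF y])
    have "T1 (x - y) (sol x (s x)) = - ?d"
      using bounded_bilinear.minus_left[OF T1, of "y - x"] by simp
    then have "sol x (s x) = sol y (s x) - sol y ?d"
      using sol_perturb[OF y x, of "s x"] sol.diff by simp
    then have "sol y (s y) - sol x (s x) = sol y (s y) - (sol y (s x) - sol y ?d)"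
      by (rule arg_cong)
    also have "\<dots> = sol y (s y - s x + ?d)"
      by (simp add: sol.add sol.diff)
    finally show ?thesis .
  qed
  have "((\<lambda>y. sol y (s y) - sol x (s x)) \<longlongrightarrow> 0) (at x)"
  proof (rule Lim_null_comparison)
    let ?g = "\<lambda>y. norm (s y - s x + T1 (y - x) (sol x (s x))) / (a - c)"
    show "\<forall>\<^sub>F y in at x. norm (sol y (s y) - sol x (s x)) \<le> ?g y"
      using eventually_norm_less[OF x] unfolding eventually_at_filter
      by eventually_elim (use eq norm_sol in auto)
    have "((\<lambda>y. T1 (y - x) (sol x (s x))) \<longlongrightarrow> T1 (x - x) (sol x (s x))) (at x)"
      by (intro bounded_bilinear.tendsto[OF T1] tendsto_intros)
    moreover have "((\<lambda>y. s y - s x) \<longlongrightarrow> s x - s x) (at x)"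
      using s by (intro tendsto_intros) (simp add: isCont_def)
    ultimately have "((\<lambda>y. s y - s x + T1 (y - x) (sol x (s x))) \<longlongrightarrow> 0) (at x)"
      using tendsto_add by (fastforce simp: bounded_bilinear.zero_left[OF T1])
    from tendsto_divide_zero[OF tendsto_norm_zero[OF this]]
    show "(?g \<longlongrightarrow> 0) (at x)" .
  qed
  then show ?thesis
    by (simp add: isCont_def LIM_zero_iff)
qed

end

text \<open>Since \<open>y - x\<close> vanishes at \<open>x\<close>, replacing \<open>p y\<close> by
  \<open>p x\<close> costs \<open>T (y - x) (p y - p x)\<close>, which is of smaller order than
  \<open>norm (y - x)\<close> by continuity of \<open>p\<close>. This avoids circularity when
  \<open>p\<close> is the solution to be differentiated.\<close>

lemma has_derivative_bilinear_vanishing: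
  assumes T: "bounded_bilinear T" and p: "isCont p x"
  shows "((\<lambda>y. T (y - x) (p y)) has_derivative (\<lambda>h. T h (p x))) (at x)"
proof (rule has_derivativeI)
  show "bounded_linear (\<lambda>h. T h (p x))"
    by (rule bounded_bilinear.bounded_linear_left[OF T])
  obtain C where C: "\<And>u v. norm (T u v) \<le> norm u * norm v * C"
    using bounded_bilinear.bounded[OF T] by blast
  have "((\<lambda>y. norm (p y - p x) * C) \<longlongrightarrow> norm (p x - p x) * C) (at x)"
    using p by (intro tendsto_intros) (simp add: isCont_def)
  then have lim: "((\<lambda>y. norm (p y - p x) * C) \<longlongrightarrow> 0) (at x)"
    by simp
  show "((\<lambda>y. (T (y - x) (p y) - T (x - x) (p x) - T (y - x) (p x)) /\<^sub>R norm (y - x)) \<longlongrightarrow> 0) (at x)"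
  proof (rule Lim_null_comparison[OF _ lim])
    show "\<forall>\<^sub>F y in at x. norm ((T (y - x) (p y) - T (x - x) (p x) - T (y - x) (p x)) /\<^sub>R norm (y - x))
        \<le> norm (p y - p x) * C"
      unfolding eventually_at_filter
    proof (intro always_eventually allI impI)
      fix y assume "y \<noteq> x"
      have "T (y - x) (p y) - T (x - x) (p x) - T (y - x) (p x) = T (y - x) (p y - p x)"
        by (simp add: bounded_bilinear.zero_left[OF T] bounded_bilinear.diff_right[OF T])
      then show "norm ((T (y - x) (p y) - T (x - x) (p x) - T (y - x) (p x)) /\<^sub>R norm (y - x))
          \<le> norm (p y - p x) * C"
        using C[of "y - x" "p y - p x"] \<open>y \<noteq> x\<close> by (simp add: divide_simps ac_simps)
    qed
  qed
qed

context damped_family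
begin

text \<open>Near \<open>x\<close> the solution is the fixed linear map \<open>sol x\<close> applied
  to \<open>s y + T1 (y - x) (sol y (s y))\<close>, whose second summand is differentiable because
  the solution is continuous.\<close>

lemma has_derivative_sol:
  assumes x: "norm x < \<rho>" and s: "(s has_derivative s') (at x)"
  shows "((\<lambda>y. sol y (s y)) has_derivative (\<lambda>h. sol x (s' h + T1 h (sol x (s x))))) (at x)"
proof (rule has_derivative_transform_eventually)
  have "isCont (\<lambda>y. sol y (s y)) x"
    using continuous_sol[OF x] s has_derivative_continuous by blast
  then show "((\<lambda>y. sol x (s y + T1 (y - x) (sol y (s y)))) has_derivative
      (\<lambda>h. sol x (s' h + T1 h (sol x (s x))))) (at x)"
    by (intro bounded_linear.has_derivative[OF bounded_linear_sol[OF x]] has_derivative_add s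
        has_derivative_bilinear_vanishing[OF T1])
  show "\<forall>\<^sub>F y in at x. sol x (s y + T1 (y - x) (sol y (s y))) = sol y (s y)"
    using eventually_norm_less[OF x] unfolding eventually_at_filter
    by eventually_elim (use sol_perturb[OF x] in auto)
qed (use sol_perturb[OF x x] in auto)

end


section \<open>Gradient and Hessian of solutions with a quadratic source term\<close>

lemma inner_axis_expansion:
  fixes f :: "real^'k \<Rightarrow> real"
  assumes "linear f"
  shows "(\<chi> i. f (axis i 1)) \<bullet> h = f h"
proof -
  have "f h = f (\<Sum>i\<in>UNIV. h $ i *\<^sub>R axis i 1)"
    by (metis basis_expansion scalar_mult_eq_scaleR)
  also have "\<dots> = (\<Sum>i\<in>UNIV. h $ i * f (axis i 1))"
    by (simp add: linear_sum[OF assms] linear_cmul[OF assms])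
  finally show ?thesis
    by (simp add: inner_vec_def mult.commute)
qed

text \<open>In the application \<open>q\<close> is the state weight and \<open>N y y\<close> the
  control weight of the gain \<open>y\<close>. That \<open>N\<close> is not symmetric in its two
  arguments, so both orders occur in the derivatives.\<close>

locale quadratic_damped_family = damped_family T0 T1 c a \<rho>
  for T0 :: "'v::euclidean_space \<Rightarrow> 'v"
    and T1 :: "real^'k \<Rightarrow> 'v \<Rightarrow> 'v"
    and c a \<rho> :: real +
  fixes N :: "real^'k \<Rightarrow> real^'k \<Rightarrow> 'v" and q :: 'v
  assumes N: "bounded_bilinear N"
begin

text \<open>Differentiating \<open>a P = T P + q + N y y\<close> once in direction \<open>h\<close> and then in direction \<open>k\<close>
  shows that the derivatives solve the same equation with a new right-hand side.\<close>

definition P :: "real^'k \<Rightarrow> 'v" where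
  "P y = sol y (q + N y y)"

definition P1 :: "real^'k \<Rightarrow> real^'k \<Rightarrow> 'v" where
  "P1 y h = sol y (N y h + N h y + T1 h (P y))"

definition P2 :: "real^'k \<Rightarrow> real^'k \<Rightarrow> real^'k \<Rightarrow> 'v" where
  "P2 y h k = sol y (N k h + N h k + T1 h (P1 y k) + T1 k (P1 y h))"

lemma P2_commute: "P2 y h k = P2 y k h"
  by (simp add: P2_def ac_simps)

lemma has_derivative_P:
  assumes "norm x < \<rho>"
  shows "(P has_derivative P1 x) (at x)"
proof -
  have "((\<lambda>y. q + N y y) has_derivative (\<lambda>h. 0 + (N x h + N h x))) (at x)"
    by (intro has_derivative_add has_derivative_const bounded_bilinear.FDERIV[OF N] has_derivative_ident)
  then have "((\<lambda>y. q + N y y) has_derivative (\<lambda>h. N x h + N h x)) (at x)"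
    by simp
  from has_derivative_sol[OF assms this] show ?thesis
    by (simp add: P_def[abs_def] P1_def[abs_def])
qed

lemma has_derivative_P1:
  assumes "norm x < \<rho>"
  shows "((\<lambda>y. P1 y h) has_derivative P2 x h) (at x)"
proof -
  have "((\<lambda>y. N y h + N h y + T1 h (P y)) has_derivative
      (\<lambda>k. N k h + N h k + T1 h (P1 x k))) (at x)"
    by (intro has_derivative_add bounded_linear_imp_has_derivative
        bounded_bilinear.bounded_linear_left[OF N] bounded_bilinear.bounded_linear_right[OF N]
        bounded_linear.has_derivative[OF bounded_bilinear.bounded_linear_right[OF T1]]
        has_derivative_P[OF assms])
  from has_derivative_sol[OF assms this] show ?thesis
    by (simp add: P2_def[abs_def] P1_def[abs_def])
qed

text \<open>Gradient and Hessian are assembled coordinatewise from \<open>P1\<close> and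
  \<open>P2\<close>; \<open>P2_commute\<close> makes the matrix symmetric, and its quadratic form is
  \<open>d \<bullet> P2 x h h\<close>.\<close>

lemma has_hessian_inner_P:
  assumes x: "norm x < \<rho>" and J: "\<And>y. norm y < \<rho> \<Longrightarrow> J y = d \<bullet> P y"
    and pos: "\<And>h. h \<noteq> 0 \<Longrightarrow> 0 < d \<bullet> P2 x h h"
  shows "\<exists>H. has_hessian J H x \<and> pos_def H"
proof -
  define g where "g y = (\<chi> i. d \<bullet> P1 y (axis i 1))" for y
  define g' where "g' k = (\<chi> i. d \<bullet> P2 x (axis i 1) k)" for k
  have lin: "linear (\<lambda>k. d \<bullet> P2 x h k)" for h
    using has_derivative_P1[OF x] by (intro bounded_linear.linear bounded_linear_inner_right_comp)
      (rule has_derivative_bounded_linear)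
  have "linear g'"
    by (rule linearI) (simp_all add: g'_def vec_eq_iff linear_add[OF lin] linear_cmul[OF lin])
  define H where "H = matrix g'"
  have H: "H *v k = g' k" for k
    using matrix_works[of g' k] \<open>linear g'\<close> by (simp add: H_def linear_matrix_vector_mul_eq)
  have "(J has_derivative (\<lambda>h. g y \<bullet> h)) (at y)" if y: "norm y < \<rho>" for y
  proof (rule has_derivative_transform_eventually)
    have "((\<lambda>y. d \<bullet> P y) has_derivative (\<lambda>h. d \<bullet> P1 y h)) (at y)"
      by (intro has_derivative_inner_right has_derivative_P y)
    moreover have "g y \<bullet> h = d \<bullet> P1 y h" for h
      unfolding g_def using has_derivative_P[OF y]
      by (intro inner_axis_expansion bounded_linear.linear bounded_linear_inner_right_comp)
        (rule has_derivative_bounded_linear)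
    ultimately show "((\<lambda>y. d \<bullet> P y) has_derivative (\<lambda>h. g y \<bullet> h)) (at y)"
      by simp
    show "\<forall>\<^sub>F z in at y. d \<bullet> P z = J z"
      using eventually_norm_less[OF y] unfolding eventually_at_filter
      by eventually_elim (use J in auto)
  qed (use J y in auto)
  \<comment> \<open>A Hessian requires the gradient on a neighbourhood of \<open>x\<close>, which
    the open ball provides.\<close>
  then have grad: "\<forall>\<^sub>F y in nhds x. (J has_derivative (\<lambda>h. g y \<bullet> h)) (at y)"
    by (rule eventually_mono[OF eventually_norm_less[OF x]])
  \<comment> \<open>Expanding \<open>g\<close> over constant basis vectors reduces its derivative to
    those of scalar coordinates.\<close>
  have "((\<lambda>y. \<Sum>i\<in>UNIV. (d \<bullet> P1 y (axis i 1)) *\<^sub>R axis i 1) has_derivative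
      (\<lambda>k. \<Sum>i\<in>UNIV. (d \<bullet> P2 x (axis i 1) k) *\<^sub>R axis i (1::real))) (at x)"
    by (rule has_derivative_sum, rule has_derivative_scaleR_left, rule has_derivative_inner_right,
        rule has_derivative_P1[OF x])
  moreover have "g = (\<lambda>y. \<Sum>i\<in>UNIV. (d \<bullet> P1 y (axis i 1)) *\<^sub>R axis i 1)"
  proof
    show "g y = (\<Sum>i\<in>UNIV. (d \<bullet> P1 y (axis i 1)) *\<^sub>R axis i 1)" for y
      using basis_expansion[of "g y", symmetric] unfolding g_def scalar_mult_eq_scaleR by simp
  qed
  moreover have "g' k = (\<Sum>i\<in>UNIV. (d \<bullet> P2 x (axis i 1) k) *\<^sub>R axis i 1)" for k
    using basis_expansion[of "g' k", symmetric] unfolding g'_def scalar_mult_eq_scaleR by simp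
  ultimately have "(g has_derivative (\<lambda>k. H *v k)) (at x)"
    unfolding H by (simp only:)
  with grad have "has_hessian J H x"
    unfolding has_hessian_def by (intro exI conjI)
  moreover have "transpose H = H"
    using P2_commute by (simp add: H_def matrix_def g'_def transpose_def vec_eq_iff)
  moreover have "0 < h \<bullet> (H *v h)" if "h \<noteq> 0" for h
  proof -
    \<comment> \<open>Symmetry moves the basis vector into the second slot, where linearity
      \<open>lin\<close> lets the coordinates be summed.\<close>
    have "g' h = (\<chi> i. d \<bullet> P2 x h (axis i 1))"
      unfolding g'_def by (subst P2_commute) (rule refl)
    then have "g' h \<bullet> h = d \<bullet> P2 x h h"
      by (simp only: inner_axis_expansion[OF lin])
    then show ?thesis
      using pos[OF that] by (simp add: H inner_commute)
  qed
  ultimately show ?thesis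
    unfolding pos_def_def by blast
qed

lemma norm_sol_le:
  assumes "norm y < \<rho>" "norm s \<le> S"
  shows "norm (sol y s) \<le> S / (a - c)"
  using norm_sol[OF assms(1), of s] divide_right_mono[OF assms(2), of "a - c"] c_less_a by linarith

text \<open>Multiplied by \<open>a\<close>, the second derivative is \<open>2 N h h + e\<close>; each application of the solution
  operator gains a factor \<open>1 / (a - c)\<close>, so \<open>e\<close> is \<open>O(1 / (a - c))\<close>.\<close>

lemma inner_P2_pos:
  assumes x: "norm x < \<rho>" and m: "0 < m" and dN: "\<And>h. m * (norm h)\<^sup>2 \<le> d \<bullet> N h h"
    and CN: "\<And>u v. norm (N u v) \<le> norm u * norm v * CN" and "0 \<le> CN"
    and CT: "\<And>u v. norm (T1 u v) \<le> norm u * norm v * CT" and "0 \<le> CT"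
    and C1: "C1 = 2 * \<rho> * CN + CT * (norm q + \<rho>\<^sup>2 * CN)"
    and C2: "C2 = 2 * CN + 2 * CT * C1"
    and "1 \<le> a - c" "0 \<le> c" and large: "norm d * (c * C2 + 2 * CT * C1) < 2 * m * (a - c)"
    and "h \<noteq> 0"
  shows "0 < d \<bullet> P2 x h h"
proof -
  have "0 < \<rho>"
    using x norm_ge_zero le_less_trans by blast
  have ac: "0 < a - c" "0 < a"
    using assms by auto
  \<comment> \<open>Where boundedness suffices, the factor \<open>1 / (a - c)\<close> is discarded;
    it is kept in the facts \<open>P1\<close> and \<open>P2\<close>, which make the error
    \<open>e\<close> small.\<close>
  have div: "u / (a - c) \<le> u" if "0 \<le> u" for u
    using \<open>1 \<le> a - c\<close> that by (simp add: divide_le_eq mult_le_cancel_left1)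
  have "norm (q + N x x) \<le> norm q + norm x * norm x * CN"
    using CN[of x x] norm_triangle_ineq[of q "N x x"] by linarith
  also have "\<dots> \<le> norm q + \<rho>\<^sup>2 * CN"
    using x \<open>0 < \<rho>\<close> \<open>0 \<le> CN\<close> unfolding power2_eq_square
    by (intro add_left_mono mult_right_mono mult_mono) auto
  finally have Px: "norm (P x) \<le> norm q + \<rho>\<^sup>2 * CN"
    using norm_sol_le[OF x, of "q + N x x"] div[of "norm q + \<rho>\<^sup>2 * CN"] \<open>0 \<le> CN\<close>
    unfolding P_def by fastforce
  have "0 \<le> C1"
    unfolding C1 using \<open>0 < \<rho>\<close> \<open>0 \<le> CN\<close> \<open>0 \<le> CT\<close> by simp
  have "norm (N x h + N h x + T1 h (P x)) \<le> norm x * norm h * CN + norm h * norm x * CN + norm h * norm (P x) * CT"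
    using CN[of x h] CN[of h x] CT[of h "P x"] norm_triangle_ineq[of "N x h" "N h x"]
      norm_triangle_ineq[of "N x h + N h x" "T1 h (P x)"] by linarith
  also have "\<dots> \<le> \<rho> * norm h * CN + norm h * \<rho> * CN + norm h * (norm q + \<rho>\<^sup>2 * CN) * CT"
    using x Px \<open>0 \<le> CN\<close> \<open>0 \<le> CT\<close> by (intro add_mono mult_right_mono mult_left_mono) auto
  also have "\<dots> = C1 * norm h"
    by (simp add: C1 algebra_simps)
  finally have P1: "norm (P1 x h) \<le> C1 * norm h / (a - c)"
    using norm_sol_le[OF x] unfolding P1_def by blast
  then have P1': "norm (P1 x h) \<le> C1 * norm h"
    using div[of "C1 * norm h"] \<open>0 \<le> C1\<close> by fastforce
  have "norm (N h h + N h h + T1 h (P1 x h) + T1 h (P1 x h)) = norm (2 *\<^sub>R N h h + 2 *\<^sub>R T1 h (P1 x h))"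
    by (simp add: scaleR_2 add.assoc)
  also have "\<dots> \<le> 2 * (norm h * norm h * CN) + 2 * (norm h * norm (P1 x h) * CT)"
    using CN[of h h] CT[of h "P1 x h"]
      norm_triangle_ineq[of "2 *\<^sub>R N h h" "2 *\<^sub>R T1 h (P1 x h)"] by simp
  also have "\<dots> \<le> 2 * (norm h * norm h * CN) + 2 * (norm h * (C1 * norm h) * CT)"
    using P1' \<open>0 \<le> CT\<close> by (intro add_mono mult_left_mono mult_right_mono) auto
  also have "\<dots> = C2 * (norm h)\<^sup>2"
    by (simp add: C2 algebra_simps power2_eq_square)
  finally have P2: "norm (P2 x h h) \<le> C2 * (norm h)\<^sup>2 / (a - c)"
    using norm_sol_le[OF x] unfolding P2_def by blast
  define e where "e = T0 (P2 x h h) + T1 x (P2 x h h) + 2 *\<^sub>R T1 h (P1 x h)"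
  have "norm e \<le> c * norm (P2 x h h) + 2 * (norm h * norm (P1 x h) * CT)"
    unfolding e_def using bound[OF x, of "P2 x h h"] CT[of h "P1 x h"]
      norm_triangle_ineq[of "T0 (P2 x h h) + T1 x (P2 x h h)" "2 *\<^sub>R T1 h (P1 x h)"] by simp
  also have "\<dots> \<le> c * (C2 * (norm h)\<^sup>2 / (a - c)) + 2 * (norm h * (C1 * norm h / (a - c)) * CT)"
    using P1 P2 \<open>0 \<le> CT\<close> \<open>0 \<le> c\<close> by (intro add_mono mult_left_mono mult_right_mono) auto
  also have "\<dots> = (c * C2 + 2 * CT * C1) * (norm h)\<^sup>2 / (a - c)"
    by (simp add: algebra_simps power2_eq_square add_divide_distrib)
  finally have "norm d * norm e \<le> norm d * ((c * C2 + 2 * CT * C1) * (norm h)\<^sup>2 / (a - c))"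
    by (rule mult_left_mono) simp
  also have "\<dots> = (norm d * (c * C2 + 2 * CT * C1)) / (a - c) * (norm h)\<^sup>2"
    by simp
  also have "\<dots> < 2 * m * (norm h)\<^sup>2"
    using large ac \<open>h \<noteq> 0\<close> by (intro mult_strict_right_mono) (simp_all add: divide_less_eq)
  finally have "\<bar>d \<bullet> e\<bar> < 2 * m * (norm h)\<^sup>2"
    using Cauchy_Schwarz_ineq2[of d e] by linarith
  moreover have "a *\<^sub>R P2 x h h = 2 *\<^sub>R N h h + e"
    using sol_eq[OF x, of "N h h + N h h + T1 h (P1 x h) + T1 h (P1 x h)"]
    by (simp add: P2_def[symmetric] e_def scaleR_2)
  then have "a * (d \<bullet> P2 x h h) = 2 * (d \<bullet> N h h) + d \<bullet> e"
    by (metis inner_add_right inner_scaleR_right)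
  ultimately have "0 < a * (d \<bullet> P2 x h h)"
    using dN[of h] by linarith
  then show ?thesis
    using \<open>0 < a\<close> zero_less_mult_pos by blast
qed

end

text \<open>The condition on \<open>J\<close> speaks of any solution \<open>p\<close>, so it can be
  checked without mentioning \<open>sol\<close>. The threshold is built from operator bounds,
  \<open>\<rho>\<close>, \<open>m\<close> and the norms of \<open>d\<close> and \<open>q\<close>,
  hence is uniform in \<open>J\<close> and \<open>x\<close>.\<close>

lemma quadratic_family_hessian_pos_def:
  fixes T0 :: "'v::euclidean_space \<Rightarrow> 'v" and T1 :: "real^'k \<Rightarrow> 'v \<Rightarrow> 'v"
    and N :: "real^'k \<Rightarrow> real^'k \<Rightarrow> 'v"
  assumes T0: "bounded_linear T0" and T1: "bounded_bilinear T1" and N: "bounded_bilinear N"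
    and m: "0 < m" and dN: "\<And>h. m * (norm h)\<^sup>2 \<le> d \<bullet> N h h"
  shows "\<exists>a0. \<forall>a\<ge>a0. \<forall>J x. norm x < \<rho> \<longrightarrow>
    (\<forall>y p. norm y < \<rho> \<longrightarrow> a *\<^sub>R p = T0 p + T1 y p + (q + N y y) \<longrightarrow> J y = d \<bullet> p) \<longrightarrow>
    (\<exists>H. has_hessian J H x \<and> pos_def H)"
proof -
  obtain C0 where C0: "\<And>p. norm (T0 p) \<le> norm p * C0" and "0 \<le> C0"
    using bounded_linear.nonneg_bounded[OF T0] by blast
  obtain CT where CT: "\<And>u v. norm (T1 u v) \<le> norm u * norm v * CT" and "0 \<le> CT"
    using bounded_bilinear.nonneg_bounded[OF T1] by blast
  obtain CN where CN: "\<And>u v. norm (N u v) \<le> norm u * norm v * CN" and "0 \<le> CN"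
    using bounded_bilinear.nonneg_bounded[OF N] by blast
  \<comment> \<open>On the ball, \<open>C1 * norm h\<close> and \<open>C2 * (norm h)\<^sup>2\<close>
    bound the right-hand sides of the equations for \<open>P1 x h\<close> and
    \<open>P2 x h h\<close>. The absolute value makes \<open>c\<close> nonnegative for either sign
    of \<rho>.\<close>
  define c where "c = C0 + \<bar>\<rho>\<bar> * CT"
  define C1 where "C1 = 2 * \<rho> * CN + CT * (norm q + \<rho>\<^sup>2 * CN)"
  define C2 where "C2 = 2 * CN + 2 * CT * C1"
  define L where "L = norm d * (c * C2 + 2 * CT * C1)"
  have "0 \<le> c"
    by (simp add: c_def \<open>0 \<le> C0\<close> \<open>0 \<le> CT\<close>)
  have bound: "norm (T0 p + T1 y p) \<le> c * norm p" if "norm y < \<rho>" for y p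
  proof -
    have "norm (T0 p + T1 y p) \<le> norm p * C0 + norm y * norm p * CT"
      using C0[of p] CT[of y p] norm_triangle_ineq[of "T0 p" "T1 y p"] by linarith
    also have "\<dots> \<le> norm p * C0 + \<bar>\<rho>\<bar> * norm p * CT"
      using that \<open>0 \<le> CT\<close> by (intro add_left_mono mult_right_mono) auto
    finally show ?thesis
      by (simp add: c_def algebra_simps)
  qed
  show ?thesis
  \<comment> \<open>The summand 1 gives \<open>1 \<le> a - c\<close>; the last one gives
    \<open>m + \<bar>L\<bar> \<le> m * (a - c)\<close>, hence
    \<open>L < 2 * m * (a - c)\<close>.\<close>
  proof (intro exI[of _ "c + 1 + \<bar>L\<bar> / m"] allI impI)
    fix a :: real and J :: "real^'k \<Rightarrow> real" and x :: "real^'k"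
    assume a: "c + 1 + \<bar>L\<bar> / m \<le> a" and x: "norm x < \<rho>"
      and J: "\<forall>y p. norm y < \<rho> \<longrightarrow> a *\<^sub>R p = T0 p + T1 y p + (q + N y y) \<longrightarrow> J y = d \<bullet> p"
    have "0 \<le> \<bar>L\<bar> / m"
      using m by simp
    then have ac: "1 \<le> a - c"
      using a by linarith
    have "\<bar>L\<bar> < 2 * m * (a - c)"
    proof -
      have "m * (1 + \<bar>L\<bar> / m) \<le> m * (a - c)"
        using a m by (intro mult_left_mono) auto
      then show ?thesis
        using m by (simp add: algebra_simps)
    qed
    then have large: "L < 2 * m * (a - c)"
      by linarith
    interpret quadratic_damped_family T0 T1 c a \<rho> N q
      by (intro quadratic_damped_family.intro damped_family.intro quadratic_damped_family_axioms.intro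
          T0 T1 N bound) (use ac in auto)
    show "\<exists>H. has_hessian J H x \<and> pos_def H"
    proof (rule has_hessian_inner_P[OF x])
      show "J y = d \<bullet> P y" if "norm y < \<rho>" for y
        using J sol_eq[OF that] that unfolding P_def by blast
      show "0 < d \<bullet> P2 x h h" if "h \<noteq> 0" for h
        using inner_P2_pos[OF x m dN CN \<open>0 \<le> CN\<close> CT \<open>0 \<le> CT\<close> C1_def C2_def ac \<open>0 \<le> c\<close> _ that]
          large L_def by blast
    qed
  qed
qed

section \<open>Linear differential equations\<close>

lemma linear_ode_solution_exists:
  fixes F :: "real^'n^'n"
  shows "\<exists>x. x 0 = \<xi> \<and> (\<forall>t. (x has_vector_derivative F *v x t) (at t))"
proof -
  define v where "v k = ((*v) F ^^ k) \<xi>" for k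
  define C where "C = onorm ((*v) F)"
  have "0 \<le> C"
    unfolding C_def by (rule onorm_pos_le) simp
  have v: "norm (v k) \<le> C ^ k * norm \<xi>" for k
  proof (induction k)
    case (Suc k)
    have "norm (v (Suc k)) \<le> C * norm (v k)"
      using onorm[of "(*v) F" "v k"] by (simp add: v_def C_def)
    also have "\<dots> \<le> C * (C ^ k * norm \<xi>)"
      using Suc \<open>0 \<le> C\<close> by (rule mult_left_mono)
    finally show ?case
      by simp
  qed (simp add: v_def)
  (* The solution is the exponential series, differentiated termwise in each coordinate. *)
  define c where "c i k = v k $ i / fact k" for i k
  have sm: "summable (\<lambda>k. c i k * t ^ k)" for i t
  proof (rule summable_comparison_test')
    show "summable (\<lambda>k. norm \<xi> * ((C * \<bar>t\<bar>) ^ k / fact k))"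
      using summable_exp[of "C * \<bar>t\<bar>"] by (intro summable_mult) (simp add: field_simps)
    fix k :: nat
    have "\<bar>v k $ i\<bar> * \<bar>t\<bar> ^ k \<le> C ^ k * norm \<xi> * \<bar>t\<bar> ^ k"
      using component_le_norm_cart[of "v k" i] v[of k] by (intro mult_right_mono) auto
    then show "norm (c i k * t ^ k) \<le> norm \<xi> * ((C * \<bar>t\<bar>) ^ k / fact k)"
      by (simp add: c_def abs_mult power_abs power_mult_distrib divide_right_mono mult.commute
          mult.left_commute)
  qed
  define x where "x t = (\<chi> i. \<Sum>k. c i k * t ^ k)" for t
  \<comment> \<open>Differentiating the series shifts the index: \<open>v (Suc k)\<close> is
    \<open>F *v v k\<close>, and the factor \<open>Suc k\<close> cancels against the
    factorial.\<close>
  have diffs: "diffs (c i) k = (\<Sum>j\<in>UNIV. F $ i $ j * c j k)" for i k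
    by (simp add: diffs_def c_def v_def matrix_vector_mult_def sum_divide_distrib[symmetric]
        del: of_nat_Suc)
  have comp: "((\<lambda>t. x t $ i) has_real_derivative (F *v x t) $ i) (at t)" for i t
  proof -
    have "(\<Sum>k. diffs (c i) k * t ^ k) = (\<Sum>k. \<Sum>j\<in>UNIV. F $ i $ j * (c j k * t ^ k))"
      by (simp add: diffs sum_distrib_right mult.assoc)
    also have "\<dots> = (\<Sum>j\<in>UNIV. F $ i $ j * (\<Sum>k. c j k * t ^ k))"
      using sm by (subst suminf_sum) (auto intro!: summable_mult simp: suminf_mult)
    finally have "(\<Sum>k. diffs (c i) k * t ^ k) = (F *v x t) $ i"
      by (simp add: matrix_vector_mult_def x_def)
    then show ?thesis
      using termdiffs_strong_converges_everywhere[OF sm, of i t] by (simp add: x_def)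
  qed
  have "(x has_vector_derivative F *v x t) (at t)" for t
    unfolding has_vector_derivative_def
  proof (subst has_derivative_componentwise_within, intro ballI)
    fix b :: "real^'n" assume "b \<in> Basis"
    then obtain i where "b = axis i 1"
      by (auto simp: Basis_vec_def)
    then show "((\<lambda>t. x t \<bullet> b) has_derivative (\<lambda>h. (h *\<^sub>R (F *v x t)) \<bullet> b)) (at t)"
      using comp[of i t] by (simp add: inner_axis has_field_derivative_def mult_commute_abs)
  qed
  moreover have "x 0 = \<xi>"
    using powser_zero[of "c i" for i] by (simp add: x_def vec_eq_iff c_def v_def)
  ultimately show ?thesis
    by blast
qed

lemma has_derivative_quadratic_form:
  fixes S :: "real^'n^'n"
  assumes "(x has_vector_derivative x') (at t)"
  shows "((\<lambda>t. x t \<bullet> (S *v x t)) has_real_derivative x' \<bullet> (S *v x t) + x t \<bullet> (S *v x')) (at t)"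
proof -
  have "((\<lambda>t. S *v x t) has_vector_derivative S *v x') (at t)"
    using assms by (rule bounded_linear.has_vector_derivative[OF matrix_vector_mul_bounded_linear])
  from bounded_bilinear.has_vector_derivative[OF bounded_bilinear_inner assms this]
  show ?thesis
    by (simp add: has_real_derivative_iff_has_vector_derivative add.commute)
qed

text \<open>Gronwall's argument: the one-sided bound makes the squared norm, weighted by
  \<open>exp (- (2 * b * t))\<close>, nonincreasing. A nonnegative \<open>b\<close> serves
  uniqueness, a negative one exponential decay.\<close>

lemma linear_ode_norm_bound:
  fixes F :: "real^'n^'n"
  assumes x: "\<And>t. (x has_vector_derivative F *v x t) (at t)"
    and F: "\<And>v. v \<bullet> (F *v v) \<le> b * (v \<bullet> v)" and "0 \<le> t"
  shows "x t \<bullet> x t \<le> exp (2 * b * t) * (x 0 \<bullet> x 0)"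
proof -
  let ?g = "\<lambda>t. exp (- (2 * b * t)) * (x t \<bullet> x t)"
  have "?g t \<le> ?g 0"
  proof (rule DERIV_nonpos_imp_nonincreasing[OF \<open>0 \<le> t\<close>], intro exI conjI)
    fix s
    have "((\<lambda>t. x t \<bullet> x t) has_real_derivative 2 * (x s \<bullet> (F *v x s))) (at s)"
      using has_derivative_quadratic_form[OF x[of s], where S = "mat 1"] by (simp add: inner_commute)
    then show "(?g has_real_derivative exp (- (2 * b * s)) * (2 * (x s \<bullet> (F *v x s)) - 2 * b * (x s \<bullet> x s))) (at s)"
      by (auto intro!: derivative_eq_intros simp: algebra_simps)
    show "exp (- (2 * b * s)) * (2 * (x s \<bullet> (F *v x s)) - 2 * b * (x s \<bullet> x s)) \<le> 0"
      using F[of "x s"] by (simp add: mult_le_0_iff)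
  qed
  then show ?thesis
    by (simp add: exp_minus field_simps)
qed

text \<open>Negative times are reduced to positive ones by reversing time, which replaces \<open>F\<close> by \<open>- F\<close>.\<close>

lemma linear_ode_unique_zero:
  fixes F :: "real^'n^'n"
  assumes x: "\<And>t. (x has_vector_derivative F *v x t) (at t)" and "x 0 = 0"
  shows "x t = 0"
proof -
  have zero: "y s = 0"
    if y: "\<And>t. (y has_vector_derivative G *v y t) (at t)" and "y 0 = 0" "0 \<le> s"
    for G :: "real^'n^'n" and y s
  proof -
    have "v \<bullet> (G *v v) \<le> onorm ((*v) G) * (v \<bullet> v)" for v
    proof -
      have "v \<bullet> (G *v v) \<le> norm v * norm (G *v v)"
        by (rule norm_cauchy_schwarz)
      also have "\<dots> \<le> norm v * (onorm ((*v) G) * norm v)"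
        by (intro mult_left_mono onorm) auto
      finally show ?thesis
        by (simp add: dot_square_norm power2_eq_square ac_simps)
    qed
    from linear_ode_norm_bound[OF y this \<open>0 \<le> s\<close>] have "y s \<bullet> y s \<le> 0"
      using \<open>y 0 = 0\<close> by simp
    then show ?thesis
      using inner_ge_zero[of "y s"] inner_eq_zero_iff[of "y s"] by linarith
  qed
  have "((\<lambda>t. x (- t)) has_vector_derivative (- F) *v x (- t)) (at t)" for t
  proof -
    have "(uminus has_vector_derivative - 1) (at t)"
      using has_vector_derivative_minus[OF has_vector_derivative_id, of "at t"] by simp
    from vector_diff_chain_at[OF this x] show ?thesis
      using matrix_vector_mult_diff_rdistrib[of 0 F "x (- t)"] by (simp add: o_def)
  qed
  from zero[OF this, of "- t"] zero[OF x, of t] show ?thesis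
    using \<open>x 0 = 0\<close> by (cases "0 \<le> t") auto
qed

text \<open>Uniqueness holds because the difference of two solutions solves the same equation from
  zero. This makes the definite description in \<open>state\<close> meaningful.\<close>

lemma linear_ode_ex1:
  fixes F :: "real^'n^'n"
  shows "\<exists>!x. x 0 = \<xi> \<and> (\<forall>t. (x has_vector_derivative F *v x t) (at t))"
proof -
  have "x = y"
    if "x 0 = \<xi>" "y 0 = \<xi>" "\<forall>t. (x has_vector_derivative F *v x t) (at t)"
      "\<forall>t. (y has_vector_derivative F *v y t) (at t)" for x y
  proof
    fix t
    have "((\<lambda>t. x t - y t) has_vector_derivative F *v (x t - y t)) (at t)" for t
      using that by (auto simp: matrix_vector_mult_diff_distrib intro!: has_vector_derivative_diff)
    from linear_ode_unique_zero[of "\<lambda>t. x t - y t", OF this] show "x t = y t"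
      using that by simp
  qed
  then show ?thesis
    using linear_ode_solution_exists[of \<xi> F] by blast
qed

text \<open>For the real and imaginary parts \<open>a\<close> and \<open>b\<close> of an
  eigenvector, the terms with \<open>Im \<mu>\<close> cancel in the sum of the two quadratic forms,
  leaving \<open>Re \<mu>\<close> times a positive number.\<close>

lemma stable_matrixI:
  fixes F :: "real^'n^'n"
  assumes F: "\<And>v. v \<bullet> (F *v v) \<le> - \<beta> * (v \<bullet> v)" and "0 < \<beta>"
  shows "stable_matrix F"
  unfolding stable_matrix_def
proof (intro allI impI)
  fix \<mu> assume "eigenvalue F \<mu>"
  then obtain v where "v \<noteq> 0" and v: "complex_matrix F *v v = \<mu> *s v"
    unfolding eigenvalue_def by blast
  define a where "a = (\<chi> i. Re (v $ i))"
  define b where "b = (\<chi> i. Im (v $ i))"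
  have comp: "(\<Sum>j\<in>UNIV. complex_of_real (F $ i $ j) * v $ j) = \<mu> * v $ i" for i
    using v by (simp add: vec_eq_iff matrix_vector_mult_def complex_matrix_def)
  have Fa: "F *v a = Re \<mu> *\<^sub>R a - Im \<mu> *\<^sub>R b"
    using arg_cong[OF comp, of Re]
    by (simp add: vec_eq_iff matrix_vector_mult_def a_def b_def)
  have Fb: "F *v b = Im \<mu> *\<^sub>R a + Re \<mu> *\<^sub>R b"
    using arg_cong[OF comp, of Im]
    by (simp add: vec_eq_iff matrix_vector_mult_def a_def b_def add.commute)
  have "a \<bullet> (F *v a) + b \<bullet> (F *v b) = Re \<mu> * (a \<bullet> a + b \<bullet> b)"
    unfolding Fa Fb by (simp add: inner_diff_right inner_add_right inner_commute algebra_simps)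
  with F[of a] F[of b] have "(Re \<mu> + \<beta>) * (a \<bullet> a + b \<bullet> b) \<le> 0"
    by (simp add: algebra_simps)
  moreover have "a \<noteq> 0 \<or> b \<noteq> 0"
    using \<open>v \<noteq> 0\<close> by (auto simp: a_def b_def vec_eq_iff complex_eq_iff)
  then have "0 < a \<bullet> a + b \<bullet> b"
    by (metis add_nonneg_pos add_pos_nonneg inner_ge_zero inner_gt_zero_iff)
  ultimately show "Re \<mu> < 0"
    using \<open>0 < \<beta>\<close> by (auto simp: mult_le_0_iff)
qed

section \<open>Matrices\<close>

text \<open>The form attains a positive minimum on the compact unit sphere; homogeneity carries the
  bound to all vectors.\<close>

lemma pos_def_lower_bound:
  fixes S :: "real^'n^'n"
  assumes "pos_def S"
  shows "\<exists>\<delta>>0. \<forall>x. \<delta> * (x \<bullet> x) \<le> x \<bullet> (S *v x)"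
proof -
  let ?f = "\<lambda>x. x \<bullet> (S *v x)"
  have "\<exists>u\<in>sphere 0 1. \<forall>x\<in>sphere 0 1. ?f u \<le> ?f x"
    by (intro continuous_attains_inf compact_sphere continuous_intros
        linear_continuous_on matrix_vector_mul_bounded_linear) (use vector_choose_size[of 1] in auto)
  then obtain u where "norm u = 1" and u: "\<And>x. norm x = 1 \<Longrightarrow> ?f u \<le> ?f x"
    by (auto simp: dist_norm)
  have "?f u * (x \<bullet> x) \<le> ?f x" for x
  proof (cases "x = 0")
    case False
    then have "?f u \<le> ?f (x /\<^sub>R norm x)"
      by (intro u) simp
    also have "\<dots> = ?f x / (x \<bullet> x)"
      by (simp add: matrix_vector_mult_scaleR dot_square_norm power2_eq_square field_simps)
    finally show ?thesis
      using False by (simp add: pos_le_divide_eq)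
  qed simp
  moreover have "0 < ?f u"
    using assms \<open>norm u = 1\<close> unfolding pos_def_def by (metis norm_zero zero_neq_one)
  ultimately show ?thesis
    by blast
qed

text \<open>The inner product of matrices is the trace pairing, so a quadratic form becomes linear
  in a rank-one matrix; this is how second moments enter.\<close>

lemma inner_outer: "outer x y \<bullet> S = x \<bullet> (S *v y)"
  by (simp add: inner_vec_def outer_def matrix_vector_mult_def sum_distrib_left ac_simps)

lemma inner_transpose_mult:
  fixes X :: "real^'n^'m"
  shows "v \<bullet> ((transpose X ** Y) *v w) = (X *v v) \<bullet> (Y *v w)"
  using dot_lmul_matrix[of v "transpose X" "Y *v w"]
  by (simp only: matrix_vector_mul_assoc vector_transpose_matrix)

lemma transpose_add: "transpose (X + Y) = transpose X + transpose (Y :: real^'n^'m)"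
  by (simp add: transpose_def vec_eq_iff)

lemma matrix_of_vec_add: "matrix_of_vec (v + w) = matrix_of_vec v + matrix_of_vec w"
  and matrix_of_vec_scaleR: "matrix_of_vec (k *\<^sub>R v) = k *\<^sub>R matrix_of_vec v"
  by (simp_all add: matrix_of_vec_def vec_eq_iff)

lemma matrix_add_rdistrib: "(X + Y) ** Z = X ** Z + Y ** (Z :: real^'p^'n)" for X :: "real^'n^'m"
  by (simp add: matrix_matrix_mult_def vec_eq_iff sum.distrib distrib_right)

lemmas matrix_linear_simps = transpose_add transpose_scalar matrix_of_vec_add matrix_of_vec_scaleR
  matrix_add_ldistrib matrix_add_rdistrib matrix_scalar_ac scalar_matrix_assoc[symmetric]
  scaleR_add_right

lemma bounded_linear_lyapunov:
  "bounded_linear (\<lambda>P :: real^'n^'n. transpose A ** P + P ** A)"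
  unfolding linear_conv_bounded_linear[symmetric]
  by (rule linearI) (simp_all add: matrix_linear_simps)

lemma bounded_bilinear_lyapunov:
  fixes B :: "real^'m^'n"
  shows "bounded_bilinear (\<lambda>(v :: real^('m \<times> 'n)) (P :: real^'n^'n).
    transpose (B ** matrix_of_vec v) ** P + P ** (B ** matrix_of_vec v))"
  unfolding bilinear_conv_bounded_bilinear[symmetric] bilinear_def
  by (intro conjI allI linearI) (simp_all add: matrix_linear_simps)

lemma bounded_bilinear_control_weight:
  fixes R :: "real^'m^'m"
  shows "bounded_bilinear (\<lambda>(v :: real^('m \<times> 'n::finite)) w.
    transpose (matrix_of_vec v) ** R ** matrix_of_vec w)"
  unfolding bilinear_conv_bounded_bilinear[symmetric] bilinear_def
  by (intro conjI allI linearI) (simp_all add: matrix_linear_simps)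

lemma bounded_bilinear_feedback:
  fixes B :: "real^'m^'n"
  shows "bounded_bilinear (\<lambda>(v :: real^('m \<times> 'n)) x. (B ** matrix_of_vec v) *v x)"
  unfolding bilinear_conv_bounded_bilinear[symmetric] bilinear_def
  by (intro conjI allI linearI)
    (simp_all add: matrix_linear_simps matrix_vector_right_distrib matrix_vector_mult_scaleR
      matrix_vector_mult_add_rdistrib scaleR_matrix_vector_assoc)

text \<open>The type-class norm on matrices is the Frobenius norm, the Euclidean norm of the
  entries.\<close>

lemma norm_matrix_of_vec: "norm (matrix_of_vec v) = norm v"
proof -
  have "(norm (matrix_of_vec v))\<^sup>2 = (norm v)\<^sup>2"
    unfolding dot_square_norm[symmetric]
    by (simp add: matrix_of_vec_def inner_vec_def sum.cartesian_product UNIV_Times_UNIV[symmetric]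
        case_prod_unfold del: UNIV_Times_UNIV)
  then show ?thesis
    by simp
qed

lemma matrix_of_vec_of_matrix: "matrix_of_vec (vec_of_matrix K) = K"
  by (simp add: matrix_of_vec_def vec_of_matrix_def vec_eq_iff)

text \<open>Every entry is at most the operator norm. The constant is crude, but any would do, as
  the radius of the parameter ball is free.\<close>

lemma norm_vec_of_matrix_le:
  fixes K :: "real^'n^'m"
  shows "norm (vec_of_matrix K) \<le> CARD('m \<times> 'n) * onorm ((*v) K)"
proof -
  have "norm (vec_of_matrix K) \<le> (\<Sum>p\<in>UNIV. \<bar>vec_of_matrix K $ p\<bar>)"
    by (rule norm_le_l1_cart)
  also have "\<dots> \<le> (\<Sum>p\<in>(UNIV :: ('m \<times> 'n) set). onorm ((*v) K))"
    by (intro sum_mono) (simp add: vec_of_matrix_def matrix_component_le_onorm)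
  finally show ?thesis
    by simp
qed

section \<open>The cost and the Lyapunov equation\<close>

text \<open>The running cost is the derivative of \<open>- (x \<bullet> P x)\<close>, and
  dissipativity drives this quantity to zero, so integrating over the half-line leaves the initial
  value.\<close>

lemma trajectory_cost_eq:
  fixes A :: "real^'n^'n" and B :: "real^'m^'n" and K :: "real^'n^'m"
  assumes Q: "pos_semidef Q" and R: "pos_def R"
    and F: "\<And>v. v \<bullet> ((damped A \<alpha> + B ** K) *v v) \<le> - \<beta> * (v \<bullet> v)" and "0 < \<beta>"
    and P: "(2 * \<alpha>) *\<^sub>R P = transpose (A + B ** K) ** P + P ** (A + B ** K)
      + (Q + transpose K ** R ** K)"
  shows "trajectory_cost A B Q R K \<alpha> \<xi> = \<xi> \<bullet> (P *v \<xi>)"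
proof -
  define F where "F = damped A \<alpha> + B ** K"
  define S where "S = Q + transpose K ** R ** K"
  define x where "x = state A B K \<alpha> \<xi>"
  have F_mult: "F *v v = damped A \<alpha> *v v + B *v (K *v v)" for v
    by (simp add: F_def matrix_vector_mult_add_rdistrib matrix_vector_mul_assoc)
  have "x 0 = \<xi> \<and> (\<forall>t. (x has_vector_derivative F *v x t) (at t))"
    unfolding x_def state_def F_mult[symmetric] by (rule theI'[OF linear_ode_ex1])
  then have x0: "x 0 = \<xi>" and x: "(x has_vector_derivative F *v x t) (at t)" for t
    by auto
  have F_split: "F *v v = (A + B ** K) *v v - \<alpha> *\<^sub>R v" for v
    by (simp add: F_def damped_def matrix_vector_mult_add_rdistrib matrix_vector_mult_diff_rdistrib
        scaleR_matrix_vector_assoc[symmetric])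
  have quad: "(2 * \<alpha>) * (v \<bullet> (P *v v)) = ((A + B ** K) *v v) \<bullet> (P *v v)
      + v \<bullet> (P *v ((A + B ** K) *v v)) + v \<bullet> (S *v v)" for v
  proof -
    have "v \<bullet> (((2 * \<alpha>) *\<^sub>R P) *v v) = v \<bullet> ((transpose (A + B ** K) ** P + P ** (A + B ** K) + S) *v v)"
      using P by (simp add: S_def)
    then show ?thesis
      by (simp only: matrix_vector_mult_add_rdistrib[of _ _ v] inner_add_right inner_transpose_mult
          scaleR_matrix_vector_assoc[symmetric] inner_scaleR_right matrix_vector_mul_assoc[symmetric, of P])
  qed
  \<comment> \<open>Damping subtracts \<alpha> times the form in each slot, which turns the equation
    for \<open>A + B ** K\<close> into the Lyapunov equation of the closed loop
    \<open>F\<close>.\<close>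
  have lyap: "(F *v v) \<bullet> (P *v v) + v \<bullet> (P *v (F *v v)) = - (v \<bullet> (S *v v))" for v
    unfolding F_split using quad[of v]
    by (simp add: inner_diff_left inner_diff_right matrix_vector_mult_diff_distrib
        matrix_vector_mult_scaleR algebra_simps)
  have S: "v \<bullet> (S *v v) = v \<bullet> (Q *v v) + (K *v v) \<bullet> (R *v (K *v v))" for v
    by (simp only: S_def matrix_vector_mult_add_rdistrib inner_add_right
        matrix_mul_assoc[symmetric] inner_transpose_mult) (simp only: matrix_vector_mul_assoc)
  have S_nonneg: "0 \<le> v \<bullet> (S *v v)" for v
    using Q R unfolding S pos_semidef_def pos_def_def
    by (metis add_nonneg_nonneg inner_zero_left less_imp_le order_refl)
  let ?f = "\<lambda>t. x t \<bullet> (S *v x t)" and ?g = "\<lambda>t. - (x t \<bullet> (P *v x t))"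
  have cont: "continuous_on UNIV x"
    using x by (intro continuous_at_imp_continuous_on ballI) (rule has_vector_derivative_continuous)
  have f_borel: "?f \<in> borel_measurable borel"
    by (intro borel_measurable_continuous_onI continuous_intros cont
        bounded_linear.continuous_on[OF matrix_vector_mul_bounded_linear])
  have deriv: "(?g has_real_derivative ?f t) (at t)" for t
    using DERIV_minus[OF has_derivative_quadratic_form[OF x[of t], where S = P]]
    by (simp only: lyap minus_minus)
  have lim: "(?g \<longlongrightarrow> 0) at_top"
  proof (rule Lim_null_comparison)
    let ?b = "\<lambda>t. onorm ((*v) P) * (exp (2 * (- \<beta>) * t) * (\<xi> \<bullet> \<xi>))"
    show "\<forall>\<^sub>F t in at_top. norm (?g t) \<le> ?b t"
      using eventually_ge_at_top[of 0]
    proof eventually_elim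
      case (elim t)
      have "\<bar>x t \<bullet> (P *v x t)\<bar> \<le> norm (x t) * norm (P *v x t)"
        by (rule Cauchy_Schwarz_ineq2)
      also have "\<dots> \<le> norm (x t) * (onorm ((*v) P) * norm (x t))"
        by (intro mult_left_mono onorm) auto
      also have "\<dots> = onorm ((*v) P) * (x t \<bullet> x t)"
        by (simp add: dot_square_norm power2_eq_square ac_simps)
      also have "\<dots> \<le> ?b t"
        using linear_ode_norm_bound[OF x F[folded F_def] elim] x0
        by (intro mult_left_mono onorm_pos_le) auto
      finally show ?case
        by simp
    qed
    have "((\<lambda>t. exp (2 * (- \<beta>) * t)) \<longlongrightarrow> 0) at_top"
      using \<open>0 < \<beta>\<close>
      by (intro filterlim_compose[OF exp_at_bot] filterlim_tendsto_neg_mult_at_bot[OF tendsto_const]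
          filterlim_ident) simp
    then show "(?b \<longlongrightarrow> 0) at_top"
      by (intro tendsto_mult_right_zero tendsto_mult_left_zero)
  qed
  \<comment> \<open>The integrand is nonnegative, so this also shows that the integral is finite:
    its Bochner value is not the default 0 of a divergent integral.\<close>
  have "(\<integral>\<^sup>+t. ennreal (?f t) * indicator {0..} t \<partial>lborel) = ennreal (0 - ?g 0)"
    using f_borel deriv S_nonneg lim by (intro nn_integral_FTC_atLeast) auto
  moreover have "(\<integral>\<^sup>+t. ennreal (?f t) * indicator {0..} t \<partial>lborel)
      = (\<integral>\<^sup>+t. ennreal (indicator {0..} t *\<^sub>R ?f t) \<partial>lborel)"
    by (intro nn_integral_cong) (simp split: split_indicator)
  \<comment> \<open>Reading the extended nonnegative value back as a real needs this sign:
    \<open>?g\<close> is nondecreasing with limit 0, so it starts at or below 0.\<close>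
  moreover have "0 \<le> \<xi> \<bullet> (P *v \<xi>)"
  proof -
    have "?g 0 \<le> 0"
    proof (rule tendsto_lowerbound[OF lim])
      show "\<forall>\<^sub>F t in at_top. ?g 0 \<le> ?g t"
        using eventually_ge_at_top[of 0]
        by eventually_elim (rule DERIV_nonneg_imp_nondecreasing, use deriv S_nonneg in auto)
    qed simp
    then show ?thesis
      by (simp add: x0)
  qed
  ultimately have "(LBINT t:{0..}. ?f t) = \<xi> \<bullet> (P *v \<xi>)"
    unfolding set_lebesgue_integral_def using f_borel S_nonneg
    by (subst integral_eq_nn_integral) (auto simp: x0)
  then show ?thesis
    by (simp add: trajectory_cost_def control_def x_def S)
qed

text \<open>Quadratic forms are linear in the outer product, so their expectations depend on the
  distribution only through \<open>D0\<close>.\<close>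

lemma initial_distribution_moment:
  assumes "initial_distribution M x0 D0"
  shows "integrable M (\<lambda>\<omega>. x0 \<omega> \<bullet> (S *v x0 \<omega>))" "(\<integral>\<omega>. x0 \<omega> \<bullet> (S *v x0 \<omega>) \<partial>M) = D0 \<bullet> S"
  using assms unfolding initial_distribution_def inner_outer[symmetric] by auto

lemma cost_eq_inner:
  fixes A :: "real^'n^'n" and B :: "real^'m^'n" and K :: "real^'n^'m"
  assumes "pos_semidef Q" "pos_def R" "initial_distribution M x0 D0"
    and "\<And>v. v \<bullet> ((damped A \<alpha> + B ** K) *v v) \<le> - \<beta> * (v \<bullet> v)" and "0 < \<beta>"
    and "(2 * \<alpha>) *\<^sub>R P = transpose (A + B ** K) ** P + P ** (A + B ** K)
      + (Q + transpose K ** R ** K)"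
  shows "cost M x0 A B Q R K \<alpha> = D0 \<bullet> P"
  unfolding cost_def trajectory_cost_eq[OF assms(1,2,4-6)]
  by (rule initial_distribution_moment[OF assms(3)])

text \<open>Writing the trace of \<open>D0 K\<^sup>T R K\<close> as the expectation of \<open>(K x0) \<bullet> (R K x0)\<close> lets \<open>R\<close> be
  replaced by a multiple of the identity without a square root of \<open>D0\<close>.\<close>

lemma inner_control_weight_lower_bound:
  fixes D0 :: "real^'n^'n" and R :: "real^'m^'m"
  assumes D0: "pos_def D0" and R: "pos_def R" and init: "initial_distribution M x0 D0"
  shows "\<exists>m>0. \<forall>K. m * (norm K)\<^sup>2 \<le> D0 \<bullet> (transpose K ** R ** K)"
proof -
  obtain \<delta> where "\<delta> > 0" and \<delta>: "\<And>x. \<delta> * (x \<bullet> x) \<le> x \<bullet> (D0 *v x)"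
    using pos_def_lower_bound[OF D0] by blast
  obtain \<rho> where "\<rho> > 0" and \<rho>: "\<And>x. \<rho> * (x \<bullet> x) \<le> x \<bullet> (R *v x)"
    using pos_def_lower_bound[OF R] by blast
  have "\<rho> * \<delta> * (norm K)\<^sup>2 \<le> D0 \<bullet> (transpose K ** R ** K)" for K :: "real^'n^'m"
  proof -
    \<comment> \<open>This is \<open>transpose K ** K\<close>, written over the rows of
      \<open>K\<close> so that pairing with \<open>D0\<close> gives one quadratic form of
      \<open>D0\<close> per row.\<close>
    let ?G = "\<Sum>i\<in>UNIV. outer (K $ i) (K $ i)"
    have G: "v \<bullet> (?G *v v) = (K *v v) \<bullet> (K *v v)" for v
    proof -
      have "v \<bullet> (?G *v v) = (\<Sum>i\<in>UNIV. outer v v \<bullet> outer (K $ i) (K $ i))"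
        by (simp add: inner_outer[symmetric] inner_sum_right)
      also have "\<dots> = (\<Sum>i\<in>UNIV. (K $ i \<bullet> v) * (K $ i \<bullet> v))"
        by (simp add: inner_vec_def outer_def sum_product ac_simps)
      also have "\<dots> = (K *v v) \<bullet> (K *v v)"
        by (subst inner_vec_def) (simp add: matrix_mult_dot)
      finally show ?thesis .
    qed
    have R': "v \<bullet> ((transpose K ** R ** K) *v v) = (K *v v) \<bullet> (R *v (K *v v))" for v
      by (simp only: matrix_mul_assoc[symmetric] inner_transpose_mult) (simp only: matrix_vector_mul_assoc)
    have "\<delta> * (norm K)\<^sup>2 = (\<Sum>i\<in>UNIV. \<delta> * (K $ i \<bullet> K $ i))"
      by (simp add: dot_square_norm[symmetric] inner_vec_def[of K] sum_distrib_left)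
    also have "\<dots> \<le> (\<Sum>i\<in>UNIV. K $ i \<bullet> (D0 *v K $ i))"
      by (intro sum_mono \<delta>)
    also have "\<dots> = D0 \<bullet> ?G"
      by (simp add: inner_outer[symmetric] inner_sum_right inner_commute)
    finally have "\<rho> * (\<delta> * (norm K)\<^sup>2) \<le> \<rho> * (D0 \<bullet> ?G)"
      using \<open>\<rho> > 0\<close> by simp
    also have "\<dots> = (\<integral>\<omega>. \<rho> * (x0 \<omega> \<bullet> (?G *v x0 \<omega>)) \<partial>M)"
      by (simp add: initial_distribution_moment[OF init])
    also have "\<dots> \<le> (\<integral>\<omega>. x0 \<omega> \<bullet> ((transpose K ** R ** K) *v x0 \<omega>) \<partial>M)"
      by (intro integral_mono integrable_mult_right initial_distribution_moment[OF init])
        (simp add: G R' \<rho>)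
    also have "\<dots> = D0 \<bullet> (transpose K ** R ** K)"
      by (rule initial_distribution_moment[OF init])
    finally show ?thesis
      by (simp add: mult.assoc)
  qed
  then show ?thesis
    using \<open>\<delta> > 0\<close> \<open>\<rho> > 0\<close> by (intro exI[of _ "\<rho> * \<delta>"]) simp
qed

section \<open>Uniform choice of the damping level\<close>

theorem theorem4:
  fixes A :: "real^'n^'n" and B :: "real^'m^'n"
    and Q :: "real^'n^'n" and R :: "real^'m^'m" and D0 :: "real^'n^'n"
    and M :: "'w measure" and x0 :: "'w \<Rightarrow> real^'n" and r :: real
  assumes "pos_semidef Q" and "pos_def R" and "pos_def D0"
    and "initial_distribution M x0 D0"
    and "r > 0"
  shows "\<exists>\<alpha>0. \<forall>\<alpha>\<ge>\<alpha>0. \<forall>K :: real^'n^'m. onorm ((*v) K) \<le> r \<longrightarrow>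
           stable_matrix (damped A \<alpha> + B ** K) \<and>
           (\<exists>H. has_hessian (\<lambda>v. cost M x0 A B Q R (matrix_of_vec v) \<alpha>) H (vec_of_matrix K) \<and>
                pos_def H)"
proof -
  \<comment> \<open>The operator-norm ball of gains lies in the Euclidean ball of this radius; the
    summand 1 puts it in the open ball, leaving room to differentiate at every such gain.\<close>
  define \<rho> where "\<rho> = CARD('m \<times> 'n) * r + 1"
  have norm_K: "norm (vec_of_matrix K) < \<rho>" if "onorm ((*v) K) \<le> r" for K :: "real^'n^'m"
    using norm_vec_of_matrix_le[of K] mult_left_mono[OF that of_nat_0_le_iff, of "CARD('m \<times> 'n)"]
    unfolding \<rho>_def by linarith
  define T0 where "T0 P = transpose A ** P + P ** A" for P
  define T1 where "T1 v P = transpose (B ** matrix_of_vec v) ** P + P ** (B ** matrix_of_vec v)"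
    for v :: "real^('m \<times> 'n)" and P
  define N where "N v w = transpose (matrix_of_vec v) ** R ** matrix_of_vec w"
    for v w :: "real^('m \<times> 'n)"
  have T0: "bounded_linear T0" and T1: "bounded_bilinear T1" and N: "bounded_bilinear N"
    unfolding T0_def[abs_def] T1_def[abs_def] N_def[abs_def]
    by (rule bounded_linear_lyapunov bounded_bilinear_lyapunov bounded_bilinear_control_weight)+
  obtain m where "0 < m" and m: "\<And>K :: real^'n^'m. m * (norm K)\<^sup>2 \<le> D0 \<bullet> (transpose K ** R ** K)"
    using inner_control_weight_lower_bound[OF assms(3,2,4)] by blast
  have "m * (norm h)\<^sup>2 \<le> D0 \<bullet> N h h" for h
    using m[of "matrix_of_vec h"] by (simp add: N_def norm_matrix_of_vec)
  \<comment> \<open>The abstract damping is \<open>2 * \<alpha>\<close>, since \<alpha> enters the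
    Lyapunov equation from both sides.\<close>
  from quadratic_family_hessian_pos_def[OF T0 T1 N \<open>0 < m\<close> this, of \<rho> Q]
  obtain a0 where a0: "\<And>a J x. a0 \<le> a \<Longrightarrow> norm x < \<rho> \<Longrightarrow>
      (\<And>y p. norm y < \<rho> \<Longrightarrow> a *\<^sub>R p = T0 p + T1 y p + (Q + N y y) \<Longrightarrow> J y = D0 \<bullet> p) \<Longrightarrow>
      \<exists>H. has_hessian J H x \<and> pos_def H"
    by blast
  obtain C where "0 \<le> C" and C: "\<And>(y :: real^('m \<times> 'n)) v. norm ((B ** matrix_of_vec y) *v v) \<le> norm y * norm v * C"
    using bounded_bilinear.nonneg_bounded[OF bounded_bilinear_feedback[of B]] by blast
  \<comment> \<open>The quadratic form of \<open>A + B ** K\<close> is at most \<open>L\<close>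
    times the squared norm on the ball, so the closed loop dissipates at rate
    \<open>\<alpha> - L\<close>.\<close>
  define L where "L = onorm ((*v) A) + \<rho> * C"
  have dissipative: "v \<bullet> ((damped A \<alpha> + B ** matrix_of_vec y) *v v) \<le> - (\<alpha> - L) * (v \<bullet> v)"
    if "norm y < \<rho>" for \<alpha> v y
  proof -
    let ?w = "A *v v + (B ** matrix_of_vec y) *v v"
    have "norm ?w \<le> onorm ((*v) A) * norm v + norm y * norm v * C"
      using onorm[OF matrix_vector_mul_bounded_linear[of A], of v] C[of y v]
        norm_triangle_ineq[of "A *v v" "(B ** matrix_of_vec y) *v v"] by linarith
    also have "\<dots> \<le> onorm ((*v) A) * norm v + \<rho> * norm v * C"
      using that \<open>0 \<le> C\<close> by (intro add_left_mono mult_right_mono) auto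
    also have "\<dots> = L * norm v"
      by (simp add: L_def algebra_simps)
    finally have "norm v * norm ?w \<le> norm v * (L * norm v)"
      by (rule mult_left_mono) simp
    then have "v \<bullet> ?w \<le> L * (v \<bullet> v)"
      using norm_cauchy_schwarz[of v ?w] by (simp add: dot_square_norm power2_eq_square ac_simps)
    then show ?thesis
      by (simp add: damped_def matrix_vector_mult_add_rdistrib matrix_vector_mult_diff_rdistrib
          scaleR_matrix_vector_assoc[symmetric] inner_add_right inner_diff_right algebra_simps)
  qed
  show ?thesis
  \<comment> \<open>\<open>a0 / 2\<close> secures the Hessian threshold for
    \<open>2 * \<alpha>\<close>, and \<open>L + 1\<close> secures
    \<open>0 < \<alpha> - L\<close>.\<close>
  proof (intro exI[of _ "max (a0 / 2) (L + 1)"] allI impI)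
    fix \<alpha> and K :: "real^'n^'m"
    assume \<alpha>: "max (a0 / 2) (L + 1) \<le> \<alpha>" and K: "onorm ((*v) K) \<le> r"
    have "0 < \<alpha> - L"
      using \<alpha> by simp
    have "stable_matrix (damped A \<alpha> + B ** K)"
      using dissipative[OF norm_K[OF K]] \<open>0 < \<alpha> - L\<close>
      unfolding matrix_of_vec_of_matrix by (rule stable_matrixI)
    moreover have "\<exists>H. has_hessian (\<lambda>v. cost M x0 A B Q R (matrix_of_vec v) \<alpha>) H (vec_of_matrix K)
        \<and> pos_def H"
    proof (rule a0[OF _ norm_K[OF K]])
      show "a0 \<le> 2 * \<alpha>"
        using \<alpha> by simp
      \<comment> \<open>The cost formula is proved on the whole ball and not only at
        \<open>K\<close>, because the Hessian depends on the cost near \<open>K\<close>.\<close>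
      fix y p
      assume y: "norm y < \<rho>" and p: "(2 * \<alpha>) *\<^sub>R p = T0 p + T1 y p + (Q + N y y)"
      have "(2 * \<alpha>) *\<^sub>R p = transpose (A + B ** matrix_of_vec y) ** p + p ** (A + B ** matrix_of_vec y)
          + (Q + transpose (matrix_of_vec y) ** R ** matrix_of_vec y)"
        unfolding p T0_def T1_def N_def by (simp add: matrix_linear_simps ac_simps)
      from cost_eq_inner[OF assms(1,2,4) dissipative[OF y] \<open>0 < \<alpha> - L\<close> this]
      show "cost M x0 A B Q R (matrix_of_vec y) \<alpha> = D0 \<bullet> p" .
    qed
    ultimately show "stable_matrix (damped A \<alpha> + B ** K) \<and>
        (\<exists>H. has_hessian (\<lambda>v. cost M x0 A B Q R (matrix_of_vec v) \<alpha>) H (vec_of_matrix K) \<and> pos_def H)"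
      by blast
  qed
qed

end
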